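(* For the norms $\|(x,y)\|_1=|x|+|y|$ and $\|(x,y)\|_\infty=\max\{|x|,|y|\}$ on $\mathbb{R}^2$, $$\Upsilon(\mathbb{R}^2,\|\cdot\|_1)=\Upsilon(\mathbb{R}^2,\|\cdot\|_\infty)=(-1,1).$$
   Context: Let $(X,\|\cdot\|)$ be a real normed vector space and $\varrho\in\mathbb{R}$. For $\vec x,\vec y\in X\setminus\{\vec 0\}$ put $\mathbf{s}=\left\|\frac{\vec x}{\|\vec x\|}+\frac{\vec y}{\|\vec y\|}\right\|$, $\mathbf{d}=\left\|\frac{\vec x}{\|\vec x\|}-\frac{\vec y}{\|\vec y\|}\right\|$, $\mathbf{\Sigma}=\mathbf{s}^2+\mathbf{d}^2$ (which is $>0$), $\mathbf{\Delta}=\mathbf{s}^2-\mathbf{d}^2$, and $\langle\vec x\,|\,\vec y\rangle_\varrho=\|\vec x\|\cdot\|\vec y\|\cdot\frac14\mathbf{\Delta}\cdot\left(\frac14\mathbf{\Sigma}\right)^{\varrho}$; put $\langle\vec x\,|\,\vec y\rangle_\varrho=0$ if $\vec x=\vec 0$ or $\vec y=\vec 0$. The space "has the angle $\angle_\varrho$" if $|\langle\vec x\,|\,\vec y\rangle_\varrho|\le\|\vec x\|\cdot\|\vec y\|$ for all $\vec x,\vec y\in X$. $\Upsilon(X,\|\cdot\|):=(\nu,\mu)$, where $\nu:=\inf\{\kappa\in\mathbb{R}\mid(X,\|\cdot\|)\text{ has the angle }\angle_\kappa\}$ and $\mu:=\sup\{\kappa\in\mathbb{R}\mid(X,\|\cdot\|)\text{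 has the angle }\angle_\kappa\}$ in the extended reals (here $(\nu,\mu)$ denotes an ordered pair). *)

theory Defs
  imports "HOL-Analysis.Analysis"
begin

(* The norm is an explicit parameter N rather than the one supplied by the type class
   real_normed_vector, since two different norms are considered on the same vector space
   (and the class norm on real \<times> real is the Euclidean one). *)

definition is_norm :: "('a::real_vector \<Rightarrow> real) \<Rightarrow> bool" where
  "is_norm N \<longleftrightarrow>
     (\<forall>x. 0 \<le> N x) \<and> (\<forall>x. N x = 0 \<longleftrightarrow> x = 0) \<and>
     (\<forall>c x. N (c *\<^sub>R x) = \<bar>c\<bar> * N x) \<and> (\<forall>x y. N (x + y) \<le> N x + N y)"

definition s_val :: "('a::real_vector \<Rightarrow> real) \<Rightarrow> 'a \<Rightarrow> 'a \<Rightarrow> real" where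
  "s_val N x y = N (x /\<^sub>R N x + y /\<^sub>R N y)"

definition d_val :: "('a::real_vector \<Rightarrow> real) \<Rightarrow> 'a \<Rightarrow> 'a \<Rightarrow> real" where
  "d_val N x y = N (x /\<^sub>R N x - y /\<^sub>R N y)"

definition Sigma_val :: "('a::real_vector \<Rightarrow> real) \<Rightarrow> 'a \<Rightarrow> 'a \<Rightarrow> real" where
  "Sigma_val N x y = (s_val N x y)\<^sup>2 + (d_val N x y)\<^sup>2"

definition Delta_val :: "('a::real_vector \<Rightarrow> real) \<Rightarrow> 'a \<Rightarrow> 'a \<Rightarrow> real" where
  "Delta_val N x y = (s_val N x y)\<^sup>2 - (d_val N x y)\<^sup>2"

(* For a norm N and nonzero x, y the base of powr is positive, see Sigma_val_pos. *)
definition rho_product :: "('a::real_vector \<Rightarrow> real) \<Rightarrow> real \<Rightarrow> 'a \<Rightarrow> 'a \<Rightarrow> real" where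
  "rho_product N \<rho> x y =
     (if x = 0 \<or> y = 0 then 0
      else N x * N y * (1 / 4 * Delta_val N x y) * (1 / 4 * Sigma_val N x y) powr \<rho>)"

definition has_angle :: "('a::real_vector \<Rightarrow> real) \<Rightarrow> real \<Rightarrow> bool" where
  "has_angle N \<rho> \<longleftrightarrow> (\<forall>x y. \<bar>rho_product N \<rho> x y\<bar> \<le> N x * N y)"

definition Upsilon :: "('a::real_vector \<Rightarrow> real) \<Rightarrow> ereal \<times> ereal" where
  "Upsilon N = (Inf (ereal ` {\<kappa>. has_angle N \<kappa>}), Sup (ereal ` {\<kappa>. has_angle N \<kappa>}))"

definition l1_norm :: "real \<times> real \<Rightarrow> real" where
  "l1_norm = (\<lambda>(x, y). \<bar>x\<bar> + \<bar>y\<bar>)"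

definition linf_norm :: "real \<times> real \<Rightarrow> real" where
  "linf_norm = (\<lambda>(x, y). max \<bar>x\<bar> \<bar>y\<bar>)"

lemma is_norm_l1_norm: "is_norm l1_norm"
  unfolding is_norm_def l1_norm_def
  by (auto simp: abs_mult algebra_simps zero_prod_def)

lemma is_norm_linf_norm: "is_norm linf_norm"
  unfolding is_norm_def linf_norm_def
  by (auto simp: abs_mult max_mult_distrib_left zero_prod_def)

lemma Sigma_val_pos:
  assumes "is_norm N" "x \<noteq> 0" "y \<noteq> 0"
  shows "0 < Sigma_val N x y"
proof (rule ccontr)
  assume "\<not> 0 < Sigma_val N x y"
  then have "(s_val N x y)\<^sup>2 + (d_val N x y)\<^sup>2 = 0"
    unfolding Sigma_val_def by (smt (verit) zero_le_power2)
  then have "s_val N x y = 0" "d_val N x y = 0"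
    by (simp_all add: sum_power2_eq_zero_iff)
  then have sum0: "x /\<^sub>R N x + y /\<^sub>R N y = 0" and diff0: "x /\<^sub>R N x - y /\<^sub>R N y = 0"
    using assms(1) by (simp_all add: is_norm_def s_val_def d_val_def)
  have "2 *\<^sub>R (x /\<^sub>R N x) = (x /\<^sub>R N x + y /\<^sub>R N y) + (x /\<^sub>R N x - y /\<^sub>R N y)"
    by (simp only: scaleR_2) (simp add: algebra_simps)
  then have "2 *\<^sub>R (x /\<^sub>R N x) = 0"
    by (simp only: sum0 diff0 add_0)
  then show False
    using assms by (simp add: is_norm_def)
qed

end

theory Submission
  imports Defs
begin

text \<open>
  For both norms the set of all \<open>\<kappa>\<close> with the angle property is exactly \<open>[-1, 1]\<close>.

  With \<open>a = s\<^sup>2 / 4\<close> and \<open>b = d\<^sup>2 / 4\<close> the property reads \<open>\<bar>a - b\<bar> (a + b)\<^sup>\<kappa> \<le> 1\<close>,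
  where the triangle inequality puts \<open>a\<close> and \<open>b\<close> into \<open>[0, 1]\<close>.  At the two ends it is elementary:
  \<open>\<bar>a\<^sup>2 - b\<^sup>2\<bar> \<le> 1\<close> for \<open>\<kappa> = 1\<close>, and \<open>\<bar>a - b\<bar> \<le> a + b\<close> for \<open>\<kappa> = -1\<close>.  Since a power is
  monotone in its exponent (in a direction that depends on whether the base exceeds \<open>1\<close>), every
  intermediate \<open>\<kappa>\<close> follows.  So every normed space has the angles \<open>[-1, 1]\<close>
  (\<open>has_angle_if_between\<close>).

  That no other angle occurs for the maximum norm is witnessed near the corner \<open>(1, 1)\<close> of the
  square.  The pair \<open>(1, 1)\<close>, \<open>(1, 1 - 2 r)\<close> lies on one edge and has \<open>a = 1\<close>, \<open>b = r\<^sup>2\<close>;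
  the pair \<open>(1, 1 - r)\<close>, \<open>(1 - r, 1)\<close> cuts off the corner, and has \<open>a - b = 1 - r\<close>,
  \<open>a + b = 1 - r + r\<^sup>2 / 2\<close>.  To first order, \<open>(1 - r\<^sup>2) (1 + r\<^sup>2)\<^sup>\<kappa>\<close> grows like
  \<open>1 + (\<kappa> - 1) r\<^sup>2\<close> and \<open>(1 - r) (1 - r + r\<^sup>2 / 2)\<^sup>\<kappa>\<close> like \<open>1 - (\<kappa> + 1) r\<close>, so small
  \<open>r\<close> refute \<open>\<kappa> > 1\<close> and \<open>\<kappa> < -1\<close>, respectively; Bernoulli's inequality makes this exact.

  The sum norm is the maximum norm in rotated and rescaled coordinates,
  \<open>\<bar>x\<bar> + \<bar>y\<bar> = max \<bar>x + y\<bar> \<bar>x - y\<bar>\<close>, and \<open>Upsilon\<close> is invariant under linear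
  isometries.
\<close>

text \<open>
  The exponent enters through \<open>t\<^sup>\<rho> \<le> max t (1 / t)\<close> alone, so only the two extreme exponents
  have to be estimated.
\<close>

lemma abs_diff_times_powr_le_1:
  fixes a b \<rho> :: real
  assumes "0 \<le> a" "a \<le> 1" "0 \<le> b" "b \<le> 1" and "0 < a + b" and "-1 \<le> \<rho>" "\<rho> \<le> 1"
  shows "\<bar>a - b\<bar> * (a + b) powr \<rho> \<le> 1"
proof (cases "1 \<le> a + b")
  case True
  have "(a + b) powr \<rho> \<le> (a + b) powr 1"
    using True assms by (intro powr_mono) auto
  then have "\<bar>a - b\<bar> * (a + b) powr \<rho> \<le> \<bar>a - b\<bar> * (a + b)"
    using assms by (intro mult_left_mono) auto
  also have "\<dots> = \<bar>a\<^sup>2 - b\<^sup>2\<bar>"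
    using assms by (simp add: power2_eq_square square_diff_square_factored abs_mult)
  also have "\<dots> \<le> 1"
    using assms power_le_one[of a 2] power_le_one[of b 2] zero_le_power2[of a] zero_le_power2[of b]
    by linarith
  finally show ?thesis .
next
  case False
  have "(a + b) powr \<rho> \<le> (a + b) powr (-1)"
    using False assms by (intro powr_mono') auto
  then have "\<bar>a - b\<bar> * (a + b) powr \<rho> \<le> \<bar>a - b\<bar> * (1 / (a + b))"
    using assms by (intro mult_left_mono) (auto simp: powr_minus_divide)
  also have "\<dots> \<le> 1"
    using assms by (simp add: field_simps)
  finally show ?thesis .
qed

lemma s_val_nonneg: "is_norm N \<Longrightarrow> 0 \<le> s_val N x y"
  and d_val_nonneg: "is_norm N \<Longrightarrow> 0 \<le> d_val N x y"
  by (auto simp: is_norm_def s_val_def d_val_def)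

lemma s_val_le_2:
  assumes "is_norm N" "x \<noteq> 0" "y \<noteq> 0"
  shows "s_val N x y \<le> 2"
proof -
  have "s_val N x y \<le> N (x /\<^sub>R N x) + N (y /\<^sub>R N y)"
    using assms unfolding is_norm_def s_val_def by blast
  also have "\<dots> = 2"
    using assms by (simp add: is_norm_def)
  finally show ?thesis .
qed

lemma d_val_le_2:
  assumes "is_norm N" "x \<noteq> 0" "y \<noteq> 0"
  shows "d_val N x y \<le> 2"
proof -
  have "N (- y) = N y"
    using assms(1) unfolding is_norm_def by (metis abs_minus_cancel abs_one mult_1 scaleR_minus1_left)
  then have "d_val N x y = s_val N x (- y)"
    by (simp add: d_val_def s_val_def)
  then show ?thesis
    using s_val_le_2[of N x "- y"] assms by simp
qed

lemma has_angle_if_between: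
  assumes N: "is_norm N" and "-1 \<le> \<rho>" "\<rho> \<le> 1"
  shows "has_angle N \<rho>"
  unfolding has_angle_def
proof (intro allI)
  fix x y
  show "\<bar>rho_product N \<rho> x y\<bar> \<le> N x * N y"
  proof (cases "x = 0 \<or> y = 0")
    case True
    then show ?thesis
      using N by (auto simp: rho_product_def is_norm_def)
  next
    case False
    define a where "a = (s_val N x y)\<^sup>2 / 4"
    define b where "b = (d_val N x y)\<^sup>2 / 4"
    have "(s_val N x y)\<^sup>2 \<le> 2\<^sup>2" "(d_val N x y)\<^sup>2 \<le> 2\<^sup>2"
      using False N by (intro power_mono s_val_le_2 d_val_le_2 s_val_nonneg d_val_nonneg; simp)+
    then have "a \<le> 1" "b \<le> 1" "0 \<le> a" "0 \<le> b"
      by (auto simp: a_def b_def)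
    moreover have "0 < a + b"
      using Sigma_val_pos[OF N, of x y] False by (simp add: a_def b_def Sigma_val_def)
    ultimately have "\<bar>a - b\<bar> * (a + b) powr \<rho> \<le> 1"
      using assms by (intro abs_diff_times_powr_le_1) auto
    moreover have nonneg: "0 \<le> N x" "0 \<le> N y"
      using N by (simp_all add: is_norm_def)
    ultimately have "N x * N y * (\<bar>a - b\<bar> * (a + b) powr \<rho>) \<le> N x * N y"
      by (intro mult_left_le) auto
    moreover have "rho_product N \<rho> x y = N x * N y * ((a - b) * (a + b) powr \<rho>)"
      using False by (simp add: rho_product_def a_def b_def Delta_val_def Sigma_val_def field_simps)
    ultimately show ?thesis
      using nonneg by (simp add: abs_mult)
  qed
qed

text \<open>
  For unit vectors the normalisation disappears, which turns a violation of the angle property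
  into a statement about \<open>N (x + y)\<close> and \<open>N (x - y)\<close>.
\<close>

lemma has_angle_unit_vectorsD:
  assumes "has_angle N \<rho>" and "x \<noteq> 0" "y \<noteq> 0" "N x = 1" "N y = 1"
  shows "\<bar>(N (x + y))\<^sup>2 / 4 - (N (x - y))\<^sup>2 / 4\<bar>
           * ((N (x + y))\<^sup>2 / 4 + (N (x - y))\<^sup>2 / 4) powr \<rho> \<le> 1"
proof -
  have "\<bar>rho_product N \<rho> x y\<bar> \<le> N x * N y"
    using assms(1) by (simp add: has_angle_def)
  then show ?thesis
    using assms(2-5)
    by (simp add: rho_product_def Delta_val_def Sigma_val_def s_val_def d_val_def abs_mult
        diff_divide_distrib add_divide_distrib)
qed

text \<open>
  Bernoulli's inequality for a real exponent is the weighted inequality between arithmetic and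
  geometric mean, for the numbers \<open>1 + \<kappa> x\<close> and \<open>1\<close> with weights \<open>1 / \<kappa>\<close> and \<open>1 - 1 / \<kappa>\<close>.
\<close>

lemma one_plus_mult_le_one_plus_powr:
  fixes \<kappa> x :: real
  assumes "1 \<le> \<kappa>" "0 \<le> x"
  shows "1 + \<kappa> * x \<le> (1 + x) powr \<kappa>"
proof -
  have pos: "0 < 1 + \<kappa> * x"
    using assms by (simp add: add_pos_nonneg)
  have "(1 + \<kappa> * x) powr (1 / \<kappa>) * 1 powr (1 - 1 / \<kappa>)
          \<le> 1 / \<kappa> * (1 + \<kappa> * x) + (1 - 1 / \<kappa>) * 1"
    using assms pos by (intro Youngs_inequality_0) auto
  also have "\<dots> = 1 + x"
    using assms by (simp add: field_simps)
  finally have "((1 + \<kappa> * x) powr (1 / \<kappa>)) powr \<kappa> \<le> (1 + x) powr \<kappa>"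
    using assms by (intro powr_mono2) auto
  then show ?thesis
    using assms pos by (simp add: powr_powr)
qed

text \<open>
  By Bernoulli's inequality the power is at least \<open>1 + \<kappa> r\<^sup>2\<close>, and
  \<open>(1 - r\<^sup>2) (1 + \<kappa> r\<^sup>2) > 1\<close> as soon as \<open>r\<^sup>2 < (\<kappa> - 1) / \<kappa>\<close>.  The choice
  \<open>r = (\<kappa> - 1) / \<kappa>\<close> achieves this because \<open>r < 1\<close>.
\<close>

lemma edge_pair_gt_1:
  fixes \<kappa> r :: real
  assumes "1 < \<kappa>" and r: "r = 1 - 1 / \<kappa>"
  shows "1 < (1 - r\<^sup>2) * (1 + r\<^sup>2) powr \<kappa>"
proof -
  have r01: "0 < r" "r < 1" and \<kappa>r: "\<kappa> * r = \<kappa> - 1"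
    using assms(1) by (simp_all add: r right_diff_distrib)
  have "r\<^sup>2 < r" "0 < r\<^sup>2"
    using r01 by (auto simp: power2_eq_square)
  then have "\<kappa> * r\<^sup>2 < \<kappa> - 1"
    using \<kappa>r assms(1) mult_strict_left_mono[of "r\<^sup>2" r \<kappa>] by simp
  then have "0 < r\<^sup>2 * (\<kappa> - 1 - \<kappa> * r\<^sup>2)"
    using \<open>0 < r\<^sup>2\<close> by simp
  then have "1 < (1 - r\<^sup>2) * (1 + \<kappa> * r\<^sup>2)"
    by (simp add: algebra_simps)
  also have "\<dots> \<le> (1 - r\<^sup>2) * (1 + r\<^sup>2) powr \<kappa>"
    using one_plus_mult_le_one_plus_powr[of \<kappa> "r\<^sup>2"] assms(1) \<open>r\<^sup>2 < r\<close> \<open>0 < r\<^sup>2\<close> r01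
    by (intro mult_left_mono) auto
  finally show ?thesis .
qed

text \<open>
  Bernoulli's inequality is applied to the reciprocal \<open>1 + w\<close> of the base, where the exponent
  \<open>\<kappa>\<close> is positive.  What remains is \<open>(1 - r) (1 + \<kappa> w) > 1\<close>; the value of \<open>r\<close> is the one with
  \<open>(1 - r) \<kappa> = 1\<close>, for which this says \<open>w > r\<close>.  That holds because
  \<open>(1 + r) (1 - r + r\<^sup>2 / 2) = 1 - r\<^sup>2 (1 - r) / 2 < 1\<close>.
\<close>

lemma corner_pair_gt_1:
  fixes \<kappa> r :: real
  assumes "1 < \<kappa>" and r: "r = 1 - 1 / \<kappa>"
  shows "1 < (1 - r) * (1 - r + r\<^sup>2 / 2) powr (- \<kappa>)"
proof -
  define B where "B = 1 - r + r\<^sup>2 / 2"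
  define w where "w = 1 / B - 1"
  have r01: "0 < r" "r < 1" and \<kappa>r: "(1 - r) * \<kappa> = 1"
    using assms(1) by (simp_all add: r)
  have B: "0 < B"
    using r01 zero_le_power2[of r] unfolding B_def by linarith
  have "0 < r\<^sup>2 * (1 - r)"
    using r01 by simp
  then have "(1 + r) * B < 1"
    by (simp add: B_def algebra_simps power2_eq_square)
  then have "r < w"
    using B by (simp add: w_def field_simps)
  then have "1 < (1 - r) + (1 - r) * \<kappa> * w"
    using \<kappa>r by simp
  also have "\<dots> = (1 - r) * (1 + \<kappa> * w)"
    by (simp add: algebra_simps)
  also have "\<dots> \<le> (1 - r) * (1 + w) powr \<kappa>"
    using one_plus_mult_le_one_plus_powr[of \<kappa> w] assms(1) \<open>r < w\<close> r01
    by (intro mult_left_mono) auto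
  also have "(1 + w) powr \<kappa> = B powr (- \<kappa>)"
    using B by (simp add: w_def powr_minus powr_divide inverse_eq_divide)
  finally show ?thesis
    by (simp add: B_def)
qed

lemma has_angle_linf_norm_le_1:
  assumes "has_angle linf_norm \<kappa>"
  shows "\<kappa> \<le> 1"
proof (rule ccontr)
  assume "\<not> \<kappa> \<le> 1"
  then have \<kappa>: "1 < \<kappa>" by simp
  define r where "r = 1 - 1 / \<kappa>"
  have r01: "0 < r" "r < 1"
    using \<kappa> by (auto simp: r_def field_simps)
  let ?x = "(1, 1) :: real \<times> real" and ?y = "(1, 1 - 2 * r) :: real \<times> real"
  have "linf_norm ?x = 1" "linf_norm ?y = 1" "linf_norm (?x + ?y) = 2" "linf_norm (?x - ?y) = 2 * r"
    using r01 by (auto simp: linf_norm_def)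
  with has_angle_unit_vectorsD[OF assms, of ?x ?y]
  have "\<bar>1 - r\<^sup>2\<bar> * (1 + r\<^sup>2) powr \<kappa> \<le> 1"
    by (simp add: zero_prod_def power_mult_distrib)
  moreover have "0 \<le> 1 - r\<^sup>2"
    using r01 power_le_one[of r 2] by simp
  ultimately show False
    using edge_pair_gt_1[OF \<kappa> r_def] by simp
qed

lemma has_angle_linf_norm_ge_minus_1:
  assumes "has_angle linf_norm \<kappa>"
  shows "-1 \<le> \<kappa>"
proof (rule ccontr)
  assume "\<not> -1 \<le> \<kappa>"
  then have \<kappa>: "1 < - \<kappa>" by simp
  define r where "r = 1 - 1 / (- \<kappa>)"
  have r01: "0 < r" "r < 1"
    using \<kappa> by (auto simp: r_def field_simps)
  let ?x = "(1, 1 - r) :: real \<times> real" and ?y = "(1 - r, 1) :: real \<times> real"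
  have "linf_norm ?x = 1" "linf_norm ?y = 1" "linf_norm (?x + ?y) = 2 - r" "linf_norm (?x - ?y) = r"
    using r01 by (auto simp: linf_norm_def)
  with has_angle_unit_vectorsD[OF assms, of ?x ?y]
  have "\<bar>(2 - r)\<^sup>2 / 4 - r\<^sup>2 / 4\<bar> * ((2 - r)\<^sup>2 / 4 + r\<^sup>2 / 4) powr \<kappa> \<le> 1"
    by (simp add: zero_prod_def)
  moreover have "(2 - r)\<^sup>2 / 4 - r\<^sup>2 / 4 = 1 - r" "(2 - r)\<^sup>2 / 4 + r\<^sup>2 / 4 = 1 - r + r\<^sup>2 / 2"
    by (auto simp: power2_eq_square field_simps)
  ultimately show False
    using corner_pair_gt_1[OF \<kappa> r_def] r01 by simp
qed

lemma has_angle_linf_norm_iff: "has_angle linf_norm \<kappa> \<longleftrightarrow> \<kappa> \<in> {-1..1}"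
  using has_angle_if_between[OF is_norm_linf_norm] has_angle_linf_norm_le_1
    has_angle_linf_norm_ge_minus_1 by auto

lemma rho_product_linear_isometry:
  assumes "linear T" "inj T"
  shows "rho_product (\<lambda>v. N (T v)) \<rho> x y = rho_product N \<rho> (T x) (T y)"
proof -
  have "T v = 0 \<longleftrightarrow> v = 0" for v
    using assms by (metis injD linear_0)
  then show ?thesis
    using assms(1)
    by (simp add: rho_product_def Delta_val_def Sigma_val_def s_val_def d_val_def
        linear_add linear_diff linear_scale)
qed

lemma Upsilon_linear_isometry:
  assumes "linear T" "bij T"
  shows "Upsilon (\<lambda>v. N (T v)) = Upsilon N"
proof -
  have "has_angle (\<lambda>v. N (T v)) \<rho> \<longleftrightarrow> has_angle N \<rho>" for \<rho>
    using assms unfolding has_angle_def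
    by (metis bij_is_inj bij_pointE rho_product_linear_isometry)
  then show ?thesis
    by (simp add: Upsilon_def)
qed

lemma Upsilon_l1_norm_eq_linf_norm: "Upsilon l1_norm = Upsilon linf_norm"
proof -
  define T :: "real \<times> real \<Rightarrow> real \<times> real" where "T = (\<lambda>(x, y). (x + y, x - y))"
  have "linear T"
    by (rule linearI) (auto simp: T_def algebra_simps)
  moreover have "bij T"
    by (rule o_bij[of "\<lambda>(u, v). ((u + v) / 2, (u - v) / 2)"])
      (auto simp: T_def fun_eq_iff field_simps)
  moreover have "l1_norm = (\<lambda>v. linf_norm (T v))"
    by (auto simp: fun_eq_iff l1_norm_def linf_norm_def T_def)
  ultimately show ?thesis
    using Upsilon_linear_isometry[of T linf_norm] by simp
qed

theorem corollary4:
  shows "Upsilon l1_norm = Upsilon linf_norm \<and> Upsilon linf_norm = (-1, 1)"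
proof -
  have "{\<kappa>. has_angle linf_norm \<kappa>} = {-1..1}"
    by (auto simp: has_angle_linf_norm_iff)
  moreover have "Inf (ereal ` {-1..1}) = -1"
    by (rule Inf_eqI) (auto simp: one_ereal_def)
  moreover have "Sup (ereal ` {-1..1}) = 1"
    by (rule Sup_eqI) (auto simp: one_ereal_def)
  ultimately show ?thesis
    by (simp add: Upsilon_def[of linf_norm] Upsilon_l1_norm_eq_linf_norm)
qed

end
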